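(* Let $P\subset\mathbb{R}^3$ be a $3$-dimensional polytope obtained as a Minkowski sum $P=P_1+\cdots+P_m$ of finitely many polygons $P_1,\dots,P_m\subset\mathbb{R}^3$. If no two distinct summands $P_i,P_j$ ($i\neq j$) share an edge direction, then $P$ is equiprojective.
   Context: A $3$-dimensional polytope $P\subset\mathbb{R}^3$ is $k$-equiprojective when its orthogonal projection onto any plane that is not orthogonal to a facet of $P$ is a polygon with exactly $k$ vertices; it is equiprojective if it is $k$-equiprojective for some $k$. A vector $u\in\mathbb{S}^2$ is an edge direction of a polytope $Q\subset\mathbb{R}^3$ (of any dimension) when its first non-zero coordinate is positive and some edge of $Q$ has its difference of vertices equal to a multiple of $u$. *)

theory Defs
  imports "HOL-Analysis.Analysis"
begin

definition polygon :: "(real^3) set \<Rightarrow> bool" where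
  "polygon Q \<longleftrightarrow> polytope Q \<and> aff_dim Q = 2"

definition minkowski_sum :: "nat \<Rightarrow> (nat \<Rightarrow> (real^3) set) \<Rightarrow> (real^3) set" where
  "minkowski_sum m Q = {(\<Sum>i<m. x i) | x. \<forall>i<m. x i \<in> Q i}"

definition first_nonzero_pos :: "real^3 \<Rightarrow> bool" where
  "first_nonzero_pos u \<longleftrightarrow>
     u$1 > 0 \<or> (u$1 = 0 \<and> u$2 > 0) \<or> (u$1 = 0 \<and> u$2 = 0 \<and> u$3 > 0)"

definition edge_direction :: "real^3 \<Rightarrow> (real^3) set \<Rightarrow> bool" where
  "edge_direction u Q \<longleftrightarrow> norm u = 1 \<and> first_nonzero_pos u \<and>
     (\<exists>e a b. e edge_of Q \<and> e = closed_segment a b \<and> a \<noteq> b \<and> (\<exists>c::real. b - a = c *\<^sub>R u))"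

definition proj_plane :: "real^3 \<Rightarrow> real^3 \<Rightarrow> real^3" where
  "proj_plane n x = x - ((x \<bullet> n) / (n \<bullet> n)) *\<^sub>R n"

text \<open>The plane with normal n is orthogonal to the facet F: their normal vectors are orthogonal.\<close>
definition plane_orth_facet :: "real^3 \<Rightarrow> (real^3) set \<Rightarrow> bool" where
  "plane_orth_facet n F \<longleftrightarrow>
     (\<exists>w. w \<noteq> 0 \<and> (\<forall>x\<in>F. \<forall>y\<in>F. w \<bullet> (x - y) = 0) \<and> w \<bullet> n = 0)"

definition k_equiprojective :: "nat \<Rightarrow> (real^3) set \<Rightarrow> bool" where
  "k_equiprojective k P \<longleftrightarrow>
     (\<forall>n. n \<noteq> 0 \<and> (\<forall>F. F facet_of P \<longrightarrow> \<not> plane_orth_facet n F) \<longrightarrow>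
        polygon (proj_plane n ` P) \<and>
        card {v. v extreme_point_of (proj_plane n ` P)} = k)"

definition equiprojective :: "(real^3) set \<Rightarrow> bool" where
  "equiprojective P \<longleftrightarrow> (\<exists>k. k_equiprojective k P)"

end

theory Submission
  imports Defs
begin

text \<open>A polygon has as many vertices as edges, hence as many vertices as outer edge normals, and the
  edge normals of a Minkowski sum of planar polygons are the union of those of the summands.
  If \<open>w\<close> is orthogonal to an admissible projection direction \<open>n\<close>, then the face of \<open>P\<close> maximising
  \<open>w\<close> is not a facet, so it is at most an edge. Applied to the normal of the plane of \<open>P\<^sub>i\<close>, this
  shows that the projection is injective on \<open>P\<^sub>i\<close>; applied to a common edge normal of the
  projections of \<open>P\<^sub>i\<close> and \<open>P\<^sub>j\<close>, it forces parallel edges of \<open>P\<^sub>i\<close> and \<open>P\<^sub>j\<close>, which is excluded.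
  So the projection has exactly as many vertices as the summands \<open>P\<^sub>i\<close> have in total.\<close>

section \<open>Support faces and edge normals\<close>

definition support_face :: "'a::real_inner \<Rightarrow> 'a set \<Rightarrow> 'a set" where
  "support_face w A = {a \<in> A. \<forall>x\<in>A. w \<bullet> x \<le> w \<bullet> a}"

text \<open>For a set spanning the plane orthogonal to \<open>n\<close>, these are the outer unit
  normals of its edges. Asking for two distinct maximisers avoids naming the edges, which makes sums
  and projections easy to handle.\<close>

definition edge_normals :: "real^3 \<Rightarrow> (real^3) set \<Rightarrow> (real^3) set" where
  "edge_normals n A =
    {w. norm w = 1 \<and> w \<bullet> n = 0 \<and> (\<exists>a\<in>support_face w A. \<exists>b\<in>support_face w A. a \<noteq> b)}"

lemma support_face_nonempty:
  assumes "compact A" "A \<noteq> {}"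
  shows "support_face w A \<noteq> {}"
proof -
  have "\<exists>x\<in>A. \<forall>y\<in>A. w \<bullet> y \<le> w \<bullet> x"
    by (rule continuous_attains_sup) (use assms in \<open>auto intro!: continuous_intros\<close>)
  then show ?thesis
    by (auto simp: support_face_def)
qed

lemma support_face_eq_Int_hyperplane:
  assumes "a \<in> support_face w A"
  shows "support_face w A = A \<inter> {x. w \<bullet> x = w \<bullet> a}"
  using assms by (force simp: support_face_def)

lemma support_face_inner_eq:
  assumes "a \<in> support_face w A" "b \<in> support_face w A"
  shows "w \<bullet> a = w \<bullet> b"
  using assms by (force simp: support_face_def)

lemma support_face_eq_self:
  assumes "\<And>a b. \<lbrakk>a \<in> A; b \<in> A\<rbrakk> \<Longrightarrow> w \<bullet> a = w \<bullet> b"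
  shows "support_face w A = A"
  unfolding support_face_def by (auto intro: eq_refl assms)

lemma face_of_support_face:
  assumes "compact A" "convex A" "A \<noteq> {}"
  shows "support_face w A face_of A"
proof -
  obtain a where a: "a \<in> support_face w A"
    using support_face_nonempty assms by blast
  show ?thesis
    unfolding support_face_eq_Int_hyperplane[OF a]
    by (rule face_of_Int_supporting_hyperplane_le) (use a assms in \<open>auto simp: support_face_def\<close>)
qed

lemma orthogonal_to_pair_exists:
  fixes n d :: "real^3"
  obtains w where "w \<noteq> 0" "w \<bullet> n = 0" "w \<bullet> d = 0"
proof -
  have "dim {n, d} \<le> card {n, d}"
    by (rule dim_le_card') simp
  also have "\<dots> \<le> 2"
    by (simp add: card_insert_if)
  finally have "dim {n, d} < DIM(real^3)"
    by simp
  then obtain w where "w \<noteq> 0" "span {n, d} \<subseteq> {x. w \<bullet> x = 0}"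
    using lowdim_subset_hyperplane by blast
  then show thesis
    using that[of w] span_base[of n "{n, d}"] span_base[of d "{n, d}"] by auto
qed

text \<open>\<open>n\<close>, \<open>w\<close> and \<open>cross3 n w\<close> form an orthonormal
  basis, so a vector orthogonal to the first two is its component along the third.\<close>

lemma eq_multiple_cross3:
  fixes n w x :: "real^3"
  assumes "norm n = 1" "norm w = 1" "w \<bullet> n = 0" "x \<bullet> n = 0" "x \<bullet> w = 0"
  shows "x = (x \<bullet> cross3 n w) *\<^sub>R cross3 n w"
proof -
  let ?J = "cross3 n w"
  have "cross3 x ?J = 0"
    by (simp add: Lagrange assms)
  then have "cross3 ?J x = 0"
    by (metis cross_skew minus_zero)
  then have "(?J \<bullet> x) *\<^sub>R ?J - (?J \<bullet> ?J) *\<^sub>R x = 0"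
    by (metis Lagrange cross_zero_right)
  moreover have "?J \<bullet> ?J = 1"
    using assms by (simp add: dot_cross inner_commute[of n w] norm_eq_1)
  ultimately show ?thesis
    by (simp add: inner_commute)
qed

section \<open>Vertices and edge normals of a planar polygon\<close>

text \<open>The last assumption says that \<open>A\<close> spans its plane. It is phrased with
  functionals because both its verification and its uses compare values of \<open>w\<close> on
  \<open>A\<close>.\<close>

locale planar_polytope =
  fixes n :: "real^3" and A :: "(real^3) set"
  assumes norm_n: "norm n = 1"
    and polytope: "polytope A"
    and planar: "x \<in> A \<Longrightarrow> x \<bullet> n = 0"
    and nondegenerate: "\<lbrakk>w \<noteq> 0; w \<bullet> n = 0\<rbrakk> \<Longrightarrow> \<exists>a\<in>A. \<exists>b\<in>A. w \<bullet> a \<noteq> w \<bullet> b"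
begin

text \<open>\<open>v\<close> is the end point of the edge with outer normal \<open>w\<close> when the boundary of \<open>A\<close> is traversed
  counterclockwise around \<open>n\<close>.\<close>
definition edge_end :: "real^3 \<Rightarrow> real^3 \<Rightarrow> bool" where
  "edge_end w v \<longleftrightarrow> v extreme_point_of A \<and> v \<in> support_face w A
     \<and> (\<exists>t>0. v - t *\<^sub>R cross3 n w \<in> A)"

lemma nonempty: "A \<noteq> {}"
  using orthogonal_to_pair_exists[of n n] nondegenerate by blast

lemma planar_diff: "\<lbrakk>x \<in> A; y \<in> A\<rbrakk> \<Longrightarrow> (x - y) \<bullet> n = 0"
  by (simp add: inner_diff_left planar)

text \<open>The end point is the point of the support face that is farthest in the direction
  \<open>cross3 n w\<close>. A face of a face is a face, so it is a vertex, and any other point of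
  the support face lies straight behind it.\<close>

lemma edge_end_exists:
  assumes w: "w \<in> edge_normals n A"
  shows "\<exists>v. edge_end w v"
proof -
  let ?J = "cross3 n w" and ?F = "support_face w A"
  have w1: "norm w = 1" "w \<bullet> n = 0"
    using w by (auto simp: edge_normals_def)
  have F: "?F face_of A"
    using face_of_support_face polytope nonempty polytope_imp_compact polytope_imp_convex by blast
  have "compact ?F"
    using F face_of_polytope_polytope polytope polytope_imp_compact by blast
  moreover have "?F \<noteq> {}"
    using w by (auto simp: edge_normals_def)
  ultimately obtain v where v: "v \<in> support_face ?J ?F"
    using support_face_nonempty by blast
  then have vF: "v \<in> ?F" and vmax: "\<And>x. x \<in> ?F \<Longrightarrow> ?J \<bullet> x \<le> ?J \<bullet> v"
    by (auto simp: support_face_def)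
  \<comment> \<open>The support face lies on the line through \<open>v\<close> in direction
    \<open>?J\<close>, so the value of \<open>?J\<close> determines a point of it.\<close>
  have line: "x = v - (?J \<bullet> (v - x)) *\<^sub>R ?J" if "x \<in> ?F" for x
  proof -
    have "(v - x) \<bullet> w = 0"
      using support_face_inner_eq[OF that vF] by (simp add: inner_diff_right inner_commute)
    moreover have "(v - x) \<bullet> n = 0"
      using that vF by (auto simp: support_face_def intro: planar_diff)
    ultimately have "v - x = ((v - x) \<bullet> ?J) *\<^sub>R ?J"
      by (intro eq_multiple_cross3 norm_n w1) auto
    then show ?thesis
      by (simp add: inner_commute algebra_simps)
  qed
  have "support_face ?J ?F = {v}"
  proof (intro equalityI subsetI)
    fix x assume x: "x \<in> support_face ?J ?F"
    then have "?J \<bullet> (v - x) = 0"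
      using support_face_inner_eq[OF x v] by (simp add: inner_diff_right)
    then show "x \<in> {v}"
      using line[of x] x by (auto simp: support_face_def)
  qed (use v in auto)
  then have "{v} face_of ?F"
    using face_of_support_face[of ?F ?J] \<open>compact ?F\<close> \<open>?F \<noteq> {}\<close> F face_of_imp_convex by metis
  then have "v extreme_point_of A"
    using F face_of_trans face_of_singleton by blast
  moreover obtain b where b: "b \<in> ?F" "b \<noteq> v"
    using w by (auto simp: edge_normals_def)
  have "?J \<bullet> (v - b) > 0"
  proof -
    have "?J \<bullet> (v - b) \<noteq> 0"
      using line[OF b(1)] b(2) by auto
    moreover have "?J \<bullet> (v - b) \<ge> 0"
      using vmax[OF b(1)] by (simp add: inner_diff_right)
    ultimately show ?thesis
      by simp
  qed
  moreover have "v - (?J \<bullet> (v - b)) *\<^sub>R ?J \<in> A"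
    using line[OF b(1)] b(1) by (auto simp: support_face_def)
  ultimately show ?thesis
    using vF unfolding edge_end_def by blast
qed

text \<open>Both candidates lie on a line in direction \<open>cross3 n w\<close>. If they differed,
  the one behind would lie strictly between the other one and a point of \<open>A\<close> still
  further back, so it would not be extreme.\<close>

lemma edge_end_unique:
  assumes w: "w \<in> edge_normals n A" and v: "edge_end w v" and u: "edge_end w u"
  shows "u = v"
proof -
  let ?J = "cross3 n w"
  have w1: "norm w = 1" "w \<bullet> n = 0"
    using w by (auto simp: edge_normals_def)
  \<comment> \<open>Stated for arbitrary end points so that it can be applied in both
    orders.\<close>
  have *: "?J \<bullet> (v - u) \<le> 0" if v: "edge_end w v" and u: "edge_end w u" for u v
  proof (rule ccontr)
    assume "\<not> ?J \<bullet> (v - u) \<le> 0"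
    define s where "s = ?J \<bullet> (v - u)"
    have s: "s > 0"
      using \<open>\<not> _\<close> by (simp add: s_def)
    obtain t where t: "t > 0" "u - t *\<^sub>R ?J \<in> A"
      using u by (auto simp: edge_end_def)
    have uv: "u \<in> support_face w A" "v \<in> support_face w A"
      using u v by (auto simp: edge_end_def)
    have "(v - u) \<bullet> w = 0"
      using support_face_inner_eq[OF uv] by (simp add: inner_diff_right inner_commute)
    moreover have "(v - u) \<bullet> n = 0"
      using uv by (auto simp: support_face_def intro: planar_diff)
    ultimately have "v - u = ((v - u) \<bullet> ?J) *\<^sub>R ?J"
      by (intro eq_multiple_cross3 norm_n w1) auto
    then have vu: "v = u + s *\<^sub>R ?J"
      by (simp add: s_def inner_commute algebra_simps)
    have "?J \<noteq> 0"
      using s by (auto simp: s_def)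
    \<comment> \<open>\<open>u\<close> lies \<open>t\<close> ahead of the first point and
      \<open>s\<close> behind \<open>v\<close>, hence the weight \<open>t / (s + t)\<close>.\<close>
    have "u = (1 - t / (s + t)) *\<^sub>R (u - t *\<^sub>R ?J) + (t / (s + t)) *\<^sub>R v"
    proof -
      have "(1 - t / (s + t)) * t = (t / (s + t)) * s"
        using s t by (simp add: field_simps)
      then have "(1 - t / (s + t)) *\<^sub>R (t *\<^sub>R ?J) = (t / (s + t)) *\<^sub>R (s *\<^sub>R ?J)"
        by (metis scaleR_scaleR)
      moreover have "(1 - t / (s + t)) *\<^sub>R (u - t *\<^sub>R ?J) + (t / (s + t)) *\<^sub>R v
          = u - (1 - t / (s + t)) *\<^sub>R (t *\<^sub>R ?J) + (t / (s + t)) *\<^sub>R (s *\<^sub>R ?J)"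
        unfolding vu by (simp add: algebra_simps)
      ultimately show ?thesis
        by (simp only: diff_add_cancel)
    qed
    moreover have "u - t *\<^sub>R ?J \<noteq> v"
    proof
      assume "u - t *\<^sub>R ?J = v"
      then have "(s + t) *\<^sub>R ?J = 0"
        unfolding vu by (simp add: algebra_simps)
      then show False
        using s t \<open>?J \<noteq> 0\<close> by simp
    qed
    moreover have "0 < t / (s + t)" "t / (s + t) < 1"
      using s t by auto
    ultimately have "u \<in> open_segment (u - t *\<^sub>R ?J) v"
      unfolding in_segment by blast
    moreover have "v \<in> A"
      using uv by (auto simp: support_face_def)
    ultimately show False
      using u t by (auto simp: edge_end_def extreme_point_of_def)
  qed
  have "?J \<bullet> (v - u) = 0"
    using *[OF v u] *[OF u v] by (simp add: inner_diff_right)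
  moreover have uv: "u \<in> support_face w A" "v \<in> support_face w A"
    using u v by (auto simp: edge_end_def)
  have "(v - u) \<bullet> w = 0"
    using support_face_inner_eq[OF uv] by (simp add: inner_diff_right inner_commute)
  moreover have "(v - u) \<bullet> n = 0"
    using uv by (auto simp: support_face_def intro: planar_diff)
  ultimately show ?thesis
    using eq_multiple_cross3[OF norm_n w1, of "v - u"] by (auto simp: inner_commute)
qed

text \<open>\<open>A\<close> has a point straight behind \<open>v\<close> along either edge, so both
  triple products of \<open>n\<close> with \<open>w\<close> and \<open>w'\<close> are nonnegative.
  They are opposite, hence zero, and the normals are parallel. Opposite normals would make
  \<open>w\<close> constant on \<open>A\<close>.\<close>

lemma edge_end_inj:
  assumes w: "w \<in> edge_normals n A" and w': "w' \<in> edge_normals n A"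
    and v: "edge_end w v" "edge_end w' v"
  shows "w = w'"
proof -
  have w1: "norm w = 1" "w \<bullet> n = 0" "norm w' = 1" "w' \<bullet> n = 0"
    using w w' by (auto simp: edge_normals_def)
  have *: "0 \<le> w \<bullet> cross3 n w'" if v: "edge_end w v" "edge_end w' v" for w w'
  proof -
    obtain t where t: "t > 0" "v - t *\<^sub>R cross3 n w' \<in> A"
      using v by (auto simp: edge_end_def)
    then have "w \<bullet> (v - t *\<^sub>R cross3 n w') \<le> w \<bullet> v"
      using v by (auto simp: edge_end_def support_face_def)
    then show ?thesis
      using t by (simp add: inner_diff_right zero_le_mult_iff)
  qed
  have "w \<bullet> cross3 n w' = - (w' \<bullet> cross3 n w)"
    by (simp add: cross3_simps)
  then have 0: "w' \<bullet> cross3 n w = 0"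
    using *[OF v] *[OF v(2,1)] by linarith
  \<comment> \<open>\<open>c\<close> is the component of \<open>w'\<close> along \<open>w\<close>;
    the remainder is orthogonal to \<open>n\<close>, \<open>w\<close> and \<open>cross3 n w\<close>,
    so it vanishes.\<close>
  define c where "c = w' \<bullet> w"
  have "(w' - c *\<^sub>R w) = ((w' - c *\<^sub>R w) \<bullet> cross3 n w) *\<^sub>R cross3 n w"
    by (rule eq_multiple_cross3[OF norm_n])
      (use w1 in \<open>auto simp: inner_diff_left dot_square_norm c_def\<close>)
  also have "\<dots> = 0"
    by (simp add: inner_diff_left 0 dot_cross_self)
  finally have w'c: "w' = c *\<^sub>R w"
    by simp
  then have "\<bar>c\<bar> = 1"
    using w1 by (metis mult.right_neutral norm_scaleR)
  moreover have "c \<noteq> - 1"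
  proof
    assume "c = - 1"
    then have "w' = - w"
      using w'c by simp
    then have "w \<bullet> x = w \<bullet> v" if "x \<in> A" for x
      using v that by (force simp: edge_end_def support_face_def)
    then show False
      using nondegenerate[of w] w1 by fastforce
  qed
  ultimately show ?thesis
    using w'c by (auto simp: abs_if split: if_splits)
qed

text \<open>The edge ending at \<open>v\<close> is found by sweeping a ray around \<open>v\<close>:
  the point \<open>u\<close> of the generating set that is extreme in angle spans with
  \<open>v\<close> a line that has all of \<open>A\<close> on one side.\<close>

lemma edge_end_surj:
  assumes v: "v extreme_point_of A"
  shows "\<exists>w\<in>edge_normals n A. edge_end w v"
proof -
  obtain V where V: "finite V" "A = convex hull V"
    using polytope by (auto simp: polytope_def)
  have vA: "v \<in> A"
    using v by (auto simp: extreme_point_of_def)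
  have VA: "V \<subseteq> A"
    using V by (simp add: hull_subset)
  have "{v} exposed_face_of A"
    by (simp add: exposed_face_of_polyhedron polytope_imp_polyhedron polytope face_of_singleton v)
  then have "\<exists>c \<beta>. A \<subseteq> {x. c \<bullet> x \<le> \<beta>} \<and> {v} = A \<inter> {x. c \<bullet> x = \<beta>}"
    by (simp only: exposed_face_of_def)
  then obtain c0 \<beta> where c0: "A \<subseteq> {x. c0 \<bullet> x \<le> \<beta>}" "{v} = A \<inter> {x. c0 \<bullet> x = \<beta>}"
    by (elim exE conjE)
  \<comment> \<open>The part of the exposing functional \<open>c0\<close> inside the plane; dropping
    the multiple of \<open>n\<close> changes no difference of values on \<open>A\<close>.\<close>
  define c where "c = c0 - (c0 \<bullet> n) *\<^sub>R n"
  have cn: "c \<bullet> n = 0"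
    using norm_n by (simp add: c_def inner_diff_left dot_square_norm)
  have c_neg: "c \<bullet> (x - v) < 0" if "x \<in> A" "x \<noteq> v" for x
  proof -
    have "c0 \<bullet> x < \<beta>" "c0 \<bullet> v = \<beta>"
      using c0 that by (fastforce simp: order.strict_iff_order)+
    moreover have "n \<bullet> (x - v) = 0"
      using planar_diff[OF that(1) vA] by (simp add: inner_commute)
    ultimately show ?thesis
      by (simp add: c_def inner_diff_left) (simp add: inner_diff_right)
  qed
  have "V - {v} \<noteq> {}"
  proof
    assume "V - {v} = {}"
    then have "A \<subseteq> {v}"
      unfolding V(2) by (intro hull_minimal) auto
    then show False
      using nondegenerate orthogonal_to_pair_exists[of n n] by (metis singletonD subsetD)
  qed
  \<comment> \<open>The neighbour of \<open>v\<close> is the vertex seen from \<open>v\<close> under the extreme slope with respect to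
    the axes \<open>c\<close> and \<open>n \<times> c\<close>.\<close>
  define f where "f x = (cross3 n c \<bullet> (x - v)) / (c \<bullet> (x - v))" for x
  obtain u where u: "u \<in> V - {v}" "\<And>x. x \<in> V - {v} \<Longrightarrow> f x \<le> f u"
  proof -
    have "Max (f ` (V - {v})) \<in> f ` (V - {v})"
      using \<open>V - {v} \<noteq> {}\<close> V(1) by (intro Max_in) auto
    then obtain u where "u \<in> V - {v}" "Max (f ` (V - {v})) = f u"
      by (rule imageE)
    then show thesis
      using that[of u] V(1) Max_ge[of "f ` (V - {v})"] by (metis finite_Diff finite_imageI imageI)
  qed
  define d where "d = u - v"
  have uA: "u \<in> A" "u \<noteq> v"
    using u VA by auto
  have dn: "d \<bullet> n = 0"
    using planar_diff[OF uA(1) vA] by (simp add: d_def)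
  have cd: "c \<bullet> d < 0"
    using c_neg uA by (simp add: d_def)
  have "d \<noteq> 0"
    using uA by (simp add: d_def)
  have c0: "c \<noteq> 0"
    using cd by auto
  \<comment> \<open>The oriented area of \<open>d\<close> and \<open>y\<close>, written as a 2x2
    determinant of their coordinates along the orthogonal axes \<open>c\<close> and
    \<open>cross3 n c\<close>. It turns the comparison of slopes into the sign of a linear
    functional.\<close>
  have det: "(c \<bullet> c) * (cross3 n d \<bullet> y) = (c \<bullet> d) * (cross3 n c \<bullet> y) - (cross3 n c \<bullet> d) * (c \<bullet> y)"
    if "y \<bullet> n = 0" for y
  proof -
    have "(c \<bullet> c) *\<^sub>R n = cross3 c (cross3 n c)"
      by (simp add: Lagrange cn)
    then have "(c \<bullet> c) * (cross3 n d \<bullet> y) = cross3 (cross3 c (cross3 n c)) d \<bullet> y"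
      by (metis cross_mult_left inner_scaleR_left)
    also have "\<dots> = cross3 c (cross3 n c) \<bullet> cross3 d y"
      by (metis cross_triple inner_commute)
    also have "\<dots> = (c \<bullet> d) * (cross3 n c \<bullet> y) - (c \<bullet> y) * (cross3 n c \<bullet> d)"
      by (simp add: dot_cross)
    finally show ?thesis
      by (simp add: mult.commute)
  qed
  have neg: "cross3 n d \<bullet> (x - v) \<le> 0" if "x \<in> V" for x
  proof (cases "x = v")
    case False
    define y where "y = x - v"
    have cy: "c \<bullet> y < 0"
      using c_neg False that VA by (auto simp: y_def)
    have yn: "y \<bullet> n = 0"
      using planar_diff[OF _ vA] that VA by (auto simp: y_def)
    have "(cross3 n c \<bullet> y) / (c \<bullet> y) \<le> (cross3 n c \<bullet> d) / (c \<bullet> d)"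
      using u(2)[of x] that False by (simp add: f_def y_def d_def)
    \<comment> \<open>Both denominators are negative, so clearing them keeps the inequality.\<close>
    then have "(cross3 n c \<bullet> y) * (c \<bullet> d) \<le> (cross3 n c \<bullet> d) * (c \<bullet> y)"
      using cy cd by (simp add: field_simps)
    then have "(c \<bullet> c) * (cross3 n d \<bullet> y) \<le> 0"
      using det[OF yn] by (simp add: mult.commute)
    then show ?thesis
      using c0 by (simp add: y_def mult_le_0_iff) (metis inner_gt_zero_iff not_less)
  qed auto
  \<comment> \<open>\<open>d\<close> turned by a quarter turn about \<open>n\<close> and normalised.
    A further quarter turn gives the unit vector from \<open>u\<close> towards \<open>v\<close>, so
    the edge is traversed from \<open>u\<close> to \<open>v\<close>.\<close>
  define w where "w = (1 / norm d) *\<^sub>R cross3 n d"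
  have nd: "norm d > 0"
    using \<open>d \<noteq> 0\<close> by simp
  have "(norm (cross3 n d))\<^sup>2 = (norm d)\<^sup>2"
    using dn by (simp add: norm_cross norm_n inner_commute)
  then have w1: "norm w = 1"
    using nd by (simp add: w_def)
  have wn: "w \<bullet> n = 0"
    by (simp add: w_def dot_cross_self inner_commute)
  have "A \<subseteq> {x. w \<bullet> x \<le> w \<bullet> v}"
    unfolding V(2)
  proof (rule hull_minimal)
    show "V \<subseteq> {x. w \<bullet> x \<le> w \<bullet> v}"
      using neg nd by (auto simp: w_def inner_diff_right divide_le_cancel)
  qed (rule convex_halfspace_le)
  then have vw: "v \<in> support_face w A"
    using vA by (auto simp: support_face_def)
  moreover have "w \<bullet> d = 0"
    by (simp add: w_def dot_cross_self)
  then have "u \<in> support_face w A"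
    using vw uA unfolding support_face_eq_Int_hyperplane[OF vw]
    by (simp add: d_def inner_diff_right)
  ultimately have "w \<in> edge_normals n A"
    using w1 wn uA by (auto simp: edge_normals_def)
  moreover have "edge_end w v"
  proof -
    have "cross3 n w = - (1 / norm d) *\<^sub>R d"
      using dn norm_n by (simp add: w_def cross_mult_right Lagrange inner_commute dot_square_norm)
    then have "v - norm d *\<^sub>R cross3 n w = u"
      using nd by (simp add: d_def)
    then show ?thesis
      using v vw nd uA unfolding edge_end_def by metis
  qed
  ultimately show ?thesis
    by blast
qed

text \<open>Sending an edge normal to the end point of its edge is the bijection.\<close>

lemma bij_edge_normals_extreme_points:
  obtains f where "bij_betw f (edge_normals n A) {v. v extreme_point_of A}"
proof -
  obtain f where f: "\<And>w. w \<in> edge_normals n A \<Longrightarrow> edge_end w (f w)"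
    using edge_end_exists by metis
  have "inj_on f (edge_normals n A)"
    using f edge_end_inj by (metis inj_onI)
  moreover have "f ` edge_normals n A = {v. v extreme_point_of A}"
  proof (intro equalityI subsetI)
    fix v assume "v \<in> {v. v extreme_point_of A}"
    then show "v \<in> f ` edge_normals n A"
      using edge_end_surj edge_end_unique f by (metis image_eqI mem_Collect_eq)
  qed (use f edge_end_def in auto)
  ultimately show thesis
    using that by (auto simp: bij_betw_def)
qed

lemma finite_edge_normals: "finite (edge_normals n A)"
  using bij_edge_normals_extreme_points bij_betw_finite polytope finite_polyhedron_extreme_points
    polytope_imp_polyhedron by metis

lemma card_edge_normals: "card (edge_normals n A) = card {v. v extreme_point_of A}"
  using bij_edge_normals_extreme_points bij_betw_same_card by metis

end


section \<open>Minkowski sums\<close>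

lemma sum_fun_upd_lessThan:
  fixes x :: "nat \<Rightarrow> 'a::ab_group_add"
  assumes "j < m"
  shows "(\<Sum>i<m. (x(j := y)) i) = (\<Sum>i<m. x i) + (y - x j)"
proof -
  have "(\<Sum>i\<in>{..<m} - {j}. (x(j := y)) i) = (\<Sum>i\<in>{..<m} - {j}. x i)"
    by (rule sum.cong) auto
  then show ?thesis
    using assms sum.remove[of "{..<m}" j "x(j := y)"] sum.remove[of "{..<m}" j x] by simp
qed

text \<open>A linear functional is maximal at a sum exactly when it is maximal at each summand:
  otherwise replacing a single summand by a better one would increase the value.\<close>

lemma support_face_minkowski_sum:
  "support_face w (minkowski_sum m Q) = minkowski_sum m (\<lambda>i. support_face w (Q i))"
proof (intro equalityI subsetI)
  fix a assume a: "a \<in> support_face w (minkowski_sum m Q)"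
  then obtain x where x: "a = (\<Sum>i<m. x i)" "\<And>i. i < m \<Longrightarrow> x i \<in> Q i"
    by (auto simp: support_face_def minkowski_sum_def)
  have "w \<bullet> y \<le> w \<bullet> x j" if "j < m" "y \<in> Q j" for j y
  proof -
    have "(\<Sum>i<m. (x(j := y)) i) \<in> minkowski_sum m Q"
      unfolding minkowski_sum_def using x that by fastforce
    then have "w \<bullet> (a + (y - x j)) \<le> w \<bullet> a"
      using a sum_fun_upd_lessThan[OF that(1), of x y] by (simp add: support_face_def x(1))
    then show ?thesis
      by (simp add: inner_add_right inner_diff_right)
  qed
  then have "\<forall>i<m. x i \<in> support_face w (Q i)"
    using x by (auto simp: support_face_def)
  then show "a \<in> minkowski_sum m (\<lambda>i. support_face w (Q i))"
    using x by (auto simp: minkowski_sum_def)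
next
  fix a assume "a \<in> minkowski_sum m (\<lambda>i. support_face w (Q i))"
  then obtain x where x: "a = (\<Sum>i<m. x i)" "\<forall>i<m. x i \<in> support_face w (Q i)"
    by (auto simp: minkowski_sum_def)
  have "a \<in> minkowski_sum m Q"
    using x by (auto simp: minkowski_sum_def support_face_def)
  moreover have "w \<bullet> b \<le> w \<bullet> a" if "b \<in> minkowski_sum m Q" for b
  proof -
    obtain y where y: "b = (\<Sum>i<m. y i)" "\<forall>i<m. y i \<in> Q i"
      using \<open>b \<in> _\<close> by (auto simp: minkowski_sum_def)
    then show ?thesis
      using x by (auto simp: inner_sum_right support_face_def intro!: sum_mono)
  qed
  ultimately show "a \<in> support_face w (minkowski_sum m Q)"
    by (simp add: support_face_def)
qed

lemma minkowski_sum_replace: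
  assumes "\<forall>i<m. c i \<in> Q i" "j < m" "y \<in> Q j"
  shows "(\<Sum>i<m. c i) + (y - c j) \<in> minkowski_sum m Q"
proof -
  have "(\<Sum>i<m. (c(j := y)) i) \<in> minkowski_sum m Q"
    unfolding minkowski_sum_def using assms by fastforce
  then show ?thesis
    by (simp only: sum_fun_upd_lessThan[OF assms(2)])
qed

lemma support_faces_choice:
  assumes "\<forall>i<m. compact (Q i) \<and> Q i \<noteq> {}"
  obtains c where "\<forall>i<m. c i \<in> support_face w (Q i)"
proof -
  have "\<forall>i\<in>{..<m}. \<exists>x. x \<in> support_face w (Q i)"
    using assms support_face_nonempty by (metis ex_in_conv lessThan_iff)
  then show thesis
    using that unfolding bchoice_iff by auto
qed

text \<open>Two distinct maximisers of the sum differ in some summand. Conversely, two distinct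
  maximisers of one summand stay distinct after adding fixed maximisers of the others, which exist
  by compactness.\<close>

lemma edge_normals_minkowski_sum:
  assumes "\<forall>i<m. compact (Q i) \<and> Q i \<noteq> {}"
  shows "edge_normals n (minkowski_sum m Q) = (\<Union>i<m. edge_normals n (Q i))"
proof (intro equalityI subsetI)
  fix w assume w: "w \<in> edge_normals n (minkowski_sum m Q)"
  then obtain a b where ab: "a \<noteq> b" "a \<in> minkowski_sum m (\<lambda>i. support_face w (Q i))"
      "b \<in> minkowski_sum m (\<lambda>i. support_face w (Q i))"
    by (auto simp: edge_normals_def support_face_minkowski_sum)
  then obtain x y where x: "a = (\<Sum>i<m. x i)" "\<forall>i<m. x i \<in> support_face w (Q i)"
    and y: "b = (\<Sum>i<m. y i)" "\<forall>i<m. y i \<in> support_face w (Q i)"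
    by (auto simp: minkowski_sum_def)
  obtain i where "i < m" "x i \<noteq> y i"
    using ab(1) x(1) y(1) by (metis lessThan_iff sum.cong)
  then show "w \<in> (\<Union>i<m. edge_normals n (Q i))"
    using w x(2) y(2) unfolding edge_normals_def by blast
next
  fix w assume "w \<in> (\<Union>i<m. edge_normals n (Q i))"
  then obtain i a b where i: "i < m" and w: "norm w = 1" "w \<bullet> n = 0"
    and ab: "a \<noteq> b" "a \<in> support_face w (Q i)" "b \<in> support_face w (Q i)"
    by (auto simp: edge_normals_def)
  obtain c where c: "\<forall>i<m. c i \<in> support_face w (Q i)"
    using support_faces_choice[OF assms] .
  let ?S = "minkowski_sum m (\<lambda>i. support_face w (Q i))"
  have "(\<Sum>i<m. c i) + (a - c i) \<in> ?S" "(\<Sum>i<m. c i) + (b - c i) \<in> ?S"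
    using minkowski_sum_replace[OF c i] ab by auto
  moreover have "(\<Sum>i<m. c i) + (a - c i) \<noteq> (\<Sum>i<m. c i) + (b - c i)"
    using ab by simp
  ultimately show "w \<in> edge_normals n (minkowski_sum m Q)"
    using w unfolding edge_normals_def support_face_minkowski_sum by blast
qed

section \<open>Orthogonal projection\<close>

lemma linear_proj_plane: "linear (proj_plane n)"
  by (rule linearI)
    (simp_all add: proj_plane_def inner_add_left add_divide_distrib algebra_simps)

lemma inner_proj_plane: "w \<bullet> n = 0 \<Longrightarrow> w \<bullet> proj_plane n x = w \<bullet> x"
  by (simp add: proj_plane_def inner_diff_right)

lemma proj_plane_orthogonal: "n \<noteq> 0 \<Longrightarrow> proj_plane n x \<bullet> n = 0"
  by (simp add: proj_plane_def inner_diff_left)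

text \<open>Allows the direction of projection to be normalised, as \<open>planar_polytope\<close>
  requires.\<close>

lemma proj_plane_scaleR: "r \<noteq> 0 \<Longrightarrow> proj_plane (r *\<^sub>R n) = proj_plane n"
  by (rule ext) (simp add: proj_plane_def)

lemma proj_plane_image_minkowski_sum:
  "proj_plane n ` minkowski_sum m Q = minkowski_sum m (\<lambda>i. proj_plane n ` Q i)"
proof (intro equalityI subsetI)
  fix a assume "a \<in> proj_plane n ` minkowski_sum m Q"
  then show "a \<in> minkowski_sum m (\<lambda>i. proj_plane n ` Q i)"
    by (force simp: minkowski_sum_def linear_sum[OF linear_proj_plane])
next
  fix a assume "a \<in> minkowski_sum m (\<lambda>i. proj_plane n ` Q i)"
  then obtain x where x: "a = (\<Sum>i<m. x i)" "\<forall>i<m. \<exists>y. y \<in> Q i \<and> x i = proj_plane n y"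
    unfolding minkowski_sum_def by blast
  then obtain y where "\<forall>i<m. y i \<in> Q i \<and> x i = proj_plane n (y i)"
    by metis
  then show "a \<in> proj_plane n ` minkowski_sum m Q"
    using x(1) by (auto simp: minkowski_sum_def linear_sum[OF linear_proj_plane] intro!: image_eqI)
qed

text \<open>A functional orthogonal to \<open>n\<close> takes the same value at a point and at its
  projection.\<close>

lemma support_face_proj_plane:
  assumes "w \<bullet> n = 0"
  shows "support_face w (proj_plane n ` A) = proj_plane n ` support_face w A"
  using assms by (auto simp: support_face_def inner_proj_plane)

text \<open>Injectivity on \<open>A\<close> makes open segments between points of \<open>A\<close>
  correspond to those between their images.\<close>

lemma extreme_points_of_linear_image_inj_on:
  fixes f :: "'a::real_vector \<Rightarrow> 'b::real_vector"
  assumes f: "linear f" and inj: "inj_on f A" and "convex A"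
  shows "{v. v extreme_point_of f ` A} = f ` {v. v extreme_point_of A}"
proof -
  have seg: "f x \<in> open_segment (f a) (f b) \<longleftrightarrow> x \<in> open_segment a b"
    if "x \<in> A" "a \<in> A" "b \<in> A" for x a b
  proof -
    have "f x = (1 - u) *\<^sub>R f a + u *\<^sub>R f b \<longleftrightarrow> x = (1 - u) *\<^sub>R a + u *\<^sub>R b"
      if "0 < u" "u < 1" for u
    proof -
      \<comment> \<open>Convexity keeps the point in \<open>A\<close>, the only place where
        \<open>f\<close> is known to be injective.\<close>
      have "(1 - u) *\<^sub>R a + u *\<^sub>R b \<in> A"
        using \<open>convex A\<close> \<open>a \<in> A\<close> \<open>b \<in> A\<close> that by (auto simp: convex_alt)
      moreover have "f ((1 - u) *\<^sub>R a + u *\<^sub>R b) = (1 - u) *\<^sub>R f a + u *\<^sub>R f b"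
        by (simp add: f linear_add linear_scale)
      ultimately show ?thesis
        using inj \<open>x \<in> A\<close> by (metis inj_onD)
    qed
    moreover have "f a = f b \<longleftrightarrow> a = b"
      using inj that by (auto dest: inj_onD)
    ultimately show ?thesis
      unfolding in_segment by blast
  qed
  show ?thesis
    using seg by (auto simp: extreme_point_of_def)
qed

section \<open>Support faces in directions orthogonal to an admissible \<open>n\<close>\<close>

text \<open>The face lies in a plane with normal \<open>w\<close>. If it had dimension 2, it would
  be a facet whose normal \<open>w\<close> is orthogonal to \<open>n\<close>, which is
  excluded.\<close>

lemma collinear_support_face:
  assumes P: "polytope P" "aff_dim P = 3"
    and n: "\<forall>F. F facet_of P \<longrightarrow> \<not> plane_orth_facet n F"
    and w: "w \<noteq> 0" "w \<bullet> n = 0"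
  shows "collinear (support_face w P)"
proof -
  let ?F = "support_face w P"
  have "P \<noteq> {}"
    using P by auto
  then have F: "?F face_of P" "?F \<noteq> {}"
    using face_of_support_face support_face_nonempty P polytope_imp_compact polytope_imp_convex
    by blast+
  then obtain a where a: "a \<in> ?F"
    by blast
  have const: "?F \<subseteq> {x. w \<bullet> x = w \<bullet> a}"
    using support_face_eq_Int_hyperplane[OF a] by blast
  have "aff_dim ?F < 3"
    using aff_dim_subset[OF const] w by simp
  moreover have "aff_dim ?F \<noteq> 2"
  proof
    assume "aff_dim ?F = 2"
    then have "?F facet_of P"
      using F P by (simp add: facet_of_def)
    moreover have "plane_orth_facet n ?F"
      unfolding plane_orth_facet_def using w support_face_inner_eq
      by (intro exI[of _ w]) (force simp: inner_diff_right)
    ultimately show False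
      using n by blast
  qed
  ultimately show ?thesis
    by (simp add: collinear_aff_dim)
qed

text \<open>Adding fixed maximisers of the other summands translates the support face of
  \<open>Q i\<close> into that of the sum.\<close>

lemma collinear_support_face_summand:
  assumes Q: "\<forall>i<m. compact (Q i) \<and> Q i \<noteq> {}"
    and F: "collinear (support_face w (minkowski_sum m Q))" and i: "i < m"
  shows "collinear (support_face w (Q i))"
proof -
  obtain c where c: "\<forall>i<m. c i \<in> support_face w (Q i)"
    using support_faces_choice[OF Q] .
  have "(+) ((\<Sum>i<m. c i) - c i) ` support_face w (Q i) \<subseteq> support_face w (minkowski_sum m Q)"
    unfolding support_face_minkowski_sum
    using minkowski_sum_replace[OF c i] by (auto simp: algebra_simps)
  then show ?thesis
    using F by (metis aff_dim_translation_eq collinear_aff_dim collinear_subset)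
qed

text \<open>Starting from a point of the collinear face, one may move its summand \<open>i\<close>
  from \<open>a\<close> to \<open>b\<close>, or its summand \<open>j\<close> from \<open>a'\<close>
  to \<open>b'\<close>, without leaving the face. Both displacements thus follow the same
  line.\<close>

lemma support_faces_parallel:
  assumes Q: "\<forall>i<m. compact (Q i) \<and> Q i \<noteq> {}"
    and F: "collinear (support_face w (minkowski_sum m Q))"
    and ij: "i < m" "j < m" "i \<noteq> j"
    and a: "a \<in> support_face w (Q i)" "b \<in> support_face w (Q i)"
    and a': "a' \<in> support_face w (Q j)" "b' \<in> support_face w (Q j)"
  obtains v s t where "b - a = s *\<^sub>R v" "b' - a' = t *\<^sub>R v"
proof -
  obtain c0 where c0: "\<forall>i<m. c0 i \<in> support_face w (Q i)"
    using support_faces_choice[OF Q] .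
  \<comment> \<open>Since \<open>i\<close> and \<open>j\<close> differ, both starting points can be
    prescribed at once.\<close>
  define c where "c = c0(i := a, j := a')"
  have c: "\<forall>i<m. c i \<in> support_face w (Q i)" "c i = a" "c j = a'"
    using c0 a a' ij by (auto simp: c_def)
  let ?S = "minkowski_sum m (\<lambda>i. support_face w (Q i))" and ?p = "\<Sum>i<m. c i"
  have "?p \<in> ?S" "?p + (b - a) \<in> ?S" "?p + (b' - a') \<in> ?S"
    using minkowski_sum_replace[OF c(1) ij(1)] minkowski_sum_replace[OF c(1) ij(2)] a a' c
    by (fastforce simp: minkowski_sum_def)+
  moreover obtain v where "\<And>x y. x \<in> ?S \<Longrightarrow> y \<in> ?S \<Longrightarrow> \<exists>r. x - y = r *\<^sub>R v"
    using F unfolding support_face_minkowski_sum collinear_def by blast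
  ultimately show thesis
    using that by (metis add_diff_cancel_left')
qed

lemma support_face_edge:
  fixes Q :: "'a::euclidean_space set"
  assumes Q: "polytope Q" and F: "collinear (support_face w Q)"
    and ab: "a \<in> support_face w Q" "b \<in> support_face w Q" "a \<noteq> b"
  obtains p q where "p \<noteq> q" "support_face w Q = closed_segment p q" "support_face w Q edge_of Q"
proof -
  let ?F = "support_face w Q"
  have "Q \<noteq> {}"
    using ab by (auto simp: support_face_def)
  then have face: "?F face_of Q"
    using face_of_support_face Q polytope_imp_compact polytope_imp_convex by blast
  have "aff_dim {a, b} \<le> aff_dim ?F"
    using ab by (intro aff_dim_subset) auto
  then have "aff_dim ?F = 1"
    using F ab(3) by (simp add: collinear_aff_dim aff_dim_2)
  then have edge: "?F edge_of Q"
    using face by (simp add: edge_of_def)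
  have "polytope ?F"
    using face Q face_of_polytope_polytope by blast
  then obtain p q where pq: "?F = closed_segment p q"
    using compact_convex_collinear_segment[of ?F] F ab polytope_imp_compact polytope_imp_convex
    by blast
  then have "p \<noteq> q"
    using ab by auto
  then show thesis
    using that pq edge by blast
qed

text \<open>Exactly the representative used by \<open>edge_direction\<close>: after scaling to norm
  1, one of the two signs is right.\<close>

lemma normalized_direction:
  assumes "v \<noteq> 0"
  obtains u c where "norm u = 1" "first_nonzero_pos u" "v = c *\<^sub>R u"
proof -
  define u where "u = (1 / norm v) *\<^sub>R v"
  have u: "norm u = 1" "v = norm v *\<^sub>R u"
    using assms by (auto simp: u_def)
  then have "u \<noteq> 0"
    by auto
  then have "first_nonzero_pos u \<or> first_nonzero_pos (- u)"
    by (auto simp: first_nonzero_pos_def vec_eq_iff forall_3)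
  then show thesis
  proof
    assume "first_nonzero_pos (- u)"
    then show thesis
      using that[of "- u" "- norm v"] u by simp
  qed (use that u in blast)
qed

text \<open>If \<open>A\<close> lay on a line with direction \<open>d\<close>, a nonzero
  \<open>w\<close> orthogonal to \<open>n\<close> and \<open>d\<close> would be constant on
  \<open>A\<close>.\<close>

lemma planar_polytope_aff_dim:
  assumes "planar_polytope n A"
  shows "aff_dim A = 2"
proof -
  interpret planar_polytope n A
    by fact
  have "n \<noteq> 0"
    using norm_n by auto
  have "A \<subseteq> {x. n \<bullet> x = 0}"
    using planar by (auto simp: inner_commute)
  then have "aff_dim A \<le> 2"
    using aff_dim_subset[of A "{x. n \<bullet> x = 0}"] \<open>n \<noteq> 0\<close> by simp
  moreover have "\<not> aff_dim A \<le> 1"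
  proof
    assume "aff_dim A \<le> 1"
    then obtain d where d: "\<And>x y. x \<in> A \<Longrightarrow> y \<in> A \<Longrightarrow> \<exists>r. x - y = r *\<^sub>R d"
      unfolding collinear_aff_dim[symmetric] collinear_def by blast
    obtain w where w: "w \<noteq> 0" "w \<bullet> n = 0" "w \<bullet> d = 0"
      using orthogonal_to_pair_exists[of n d] .
    then obtain a b where ab: "a \<in> A" "b \<in> A" "w \<bullet> a \<noteq> w \<bullet> b"
      using nondegenerate by blast
    obtain r where "a - b = r *\<^sub>R d"
      using d ab by blast
    then have "w \<bullet> (a - b) = 0"
      using w by simp
    then show False
      using ab by (simp add: inner_diff_right)
  qed
  ultimately show ?thesis
    by simp
qed

section \<open>Counting the vertices of a projection\<close>

theorem theorem1p3:
  fixes m :: nat and Q :: "nat \<Rightarrow> (real^3) set" and P :: "(real^3) set"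
  assumes "\<forall>i<m. polygon (Q i)"
    and "P = minkowski_sum m Q"
    and "polytope P" and "aff_dim P = 3"
    and "\<forall>i<m. \<forall>j<m. i \<noteq> j \<longrightarrow> \<not> (\<exists>u. edge_direction u (Q i) \<and> edge_direction u (Q j))"
  shows "equiprojective P"
proof -
  have polyQ: "polytope (Q i)" "aff_dim (Q i) = 2" if "i < m" for i
    using assms(1) that by (auto simp: polygon_def)
  have Q: "\<forall>i<m. compact (Q i) \<and> Q i \<noteq> {}"
    using polyQ polytope_imp_compact by fastforce
  \<comment> \<open>The total number of vertices of the summands, which does not depend on the
    direction of projection.\<close>
  define k where "k = (\<Sum>i<m. card {v. v extreme_point_of Q i})"
  have "polygon (proj_plane n0 ` P) \<and> card {v. v extreme_point_of (proj_plane n0 ` P)} = k"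
    if n0: "n0 \<noteq> 0" "\<forall>F. F facet_of P \<longrightarrow> \<not> plane_orth_facet n0 F" for n0
  proof -
    define n where "n = (1 / norm n0) *\<^sub>R n0"
    have norm_n: "norm n = 1"
      using n0 by (simp add: n_def)
    then have "n \<noteq> 0"
      by auto
    have proj: "proj_plane n0 = proj_plane n"
      using n0 by (simp add: n_def proj_plane_scaleR)
    have coll: "collinear (support_face w P)" if "w \<noteq> 0" "w \<bullet> n = 0" for w
      using collinear_support_face[OF assms(3,4) n0(2)] that n0 by (simp add: n_def)
    have collQ: "collinear (support_face w (Q i))" if "w \<noteq> 0" "w \<bullet> n = 0" "i < m" for w i
      using collinear_support_face_summand[OF Q] coll that unfolding assms(2) by blast
    have nonconst: "\<exists>a\<in>Q i. \<exists>b\<in>Q i. w \<bullet> a \<noteq> w \<bullet> b"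
      if "w \<noteq> 0" "w \<bullet> n = 0" "i < m" for w i
    proof (rule ccontr)
      assume "\<not> ?thesis"
      then have "support_face w (Q i) = Q i"
        by (intro support_face_eq_self) blast
      then show False
        using collQ[OF that] polyQ[OF that(3)] by (simp add: collinear_aff_dim)
    qed
    have injQ: "inj_on (proj_plane n) (Q i)" if i: "i < m" for i
    proof (rule inj_onI)
      fix a b assume ab: "a \<in> Q i" "b \<in> Q i" "proj_plane n a = proj_plane n b"
      obtain w \<beta> where w: "w \<noteq> 0" "Q i \<subseteq> {x. w \<bullet> x = \<beta>}"
        using aff_lowdim_subset_hyperplane[of "Q i"] polyQ(2)[OF i] by auto
      \<comment> \<open>\<open>w\<close> is normal to the plane of \<open>Q i\<close>, hence
        constant on \<open>Q i\<close>. So \<open>n\<close> is not parallel to that plane, and no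
        nonzero difference of points of \<open>Q i\<close> is a multiple of
        \<open>n\<close>.\<close>
      then have "w \<bullet> n \<noteq> 0"
        using nonconst[OF w(1) _ i] by blast
      have "proj_plane n (a - b) = 0"
        using ab by (simp add: linear_diff[OF linear_proj_plane])
      then have eq: "a - b = ((a - b) \<bullet> n) *\<^sub>R n"
        using norm_n by (simp add: proj_plane_def norm_eq_1)
      have "w \<bullet> (a - b) = 0"
        using ab w by (auto simp: inner_diff_right)
      then have "(a - b) \<bullet> n = 0"
        using eq \<open>w \<bullet> n \<noteq> 0\<close> by (metis inner_scaleR_right mult_eq_0_iff)
      then show "a = b"
        using eq by simp
    qed
    have planarQ: "planar_polytope n (proj_plane n ` Q i)" if "i < m" for i
    proof
      show "polytope (proj_plane n ` Q i)"
        using that polyQ linear_proj_plane polytope_linear_image by blast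
    qed (use that nonconst norm_n \<open>n \<noteq> 0\<close> in
        \<open>auto simp: proj_plane_orthogonal inner_proj_plane\<close>)
    have planarP: "planar_polytope n (proj_plane n ` P)"
    proof
      show "polytope (proj_plane n ` P)"
        using assms(3) linear_proj_plane polytope_linear_image by blast
      show "\<exists>a\<in>proj_plane n ` P. \<exists>b\<in>proj_plane n ` P. w \<bullet> a \<noteq> w \<bullet> b"
        if w: "w \<noteq> 0" "w \<bullet> n = 0" for w
      proof (rule ccontr)
        assume "\<not> ?thesis"
        then have "support_face w P = P"
          by (intro support_face_eq_self) (use inner_proj_plane[OF w(2)] in \<open>metis image_eqI\<close>)
        then show False
          using coll[OF w] assms(4) by (simp add: collinear_aff_dim)
      qed
    qed (use norm_n \<open>n \<noteq> 0\<close> in \<open>auto simp: proj_plane_orthogonal\<close>)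
    have disjoint: "edge_normals n (proj_plane n ` Q i) \<inter> edge_normals n (proj_plane n ` Q j) = {}"
      if ij: "i < m" "j < m" "i \<noteq> j" for i j
    proof (rule ccontr)
      assume "\<not> ?thesis"
      then obtain w where w: "w \<in> edge_normals n (proj_plane n ` Q i)"
          "w \<in> edge_normals n (proj_plane n ` Q j)"
        by blast
      then have w1: "w \<noteq> 0" "w \<bullet> n = 0"
        by (auto simp: edge_normals_def)
      have edge: "\<exists>p q. p \<noteq> q \<and> support_face w (Q l) = closed_segment p q
          \<and> support_face w (Q l) edge_of Q l"
        if l: "l < m" "w \<in> edge_normals n (proj_plane n ` Q l)" for l
      proof -
        obtain a b where "a \<in> support_face w (Q l)" "b \<in> support_face w (Q l)" "a \<noteq> b"
          using l(2) by (fastforce simp: edge_normals_def support_face_proj_plane)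
        then show ?thesis
          using support_face_edge[OF polyQ(1)[OF l(1)] collQ[OF w1 l(1)]] by metis
      qed
      obtain p q where pq: "p \<noteq> q" "support_face w (Q i) = closed_segment p q"
          "support_face w (Q i) edge_of Q i"
        using edge[OF ij(1) w(1)] by blast
      obtain p' q' where pq': "p' \<noteq> q'" "support_face w (Q j) = closed_segment p' q'"
          "support_face w (Q j) edge_of Q j"
        using edge[OF ij(2) w(2)] by blast
      \<comment> \<open>Both edges are summands of the same collinear face of \<open>P\<close>, so
        they are parallel and one unit vector \<open>u\<close> serves as edge direction of
        both.\<close>
      obtain v s t where v: "q - p = s *\<^sub>R v" "q' - p' = t *\<^sub>R v"
        by (rule support_faces_parallel[OF Q coll[OF w1, unfolded assms(2)] ij, of p q p' q'])
          (use pq(2) pq'(2) in auto)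
      have "v \<noteq> 0"
        using v pq by auto
      then obtain u c where u: "norm u = 1" "first_nonzero_pos u" "v = c *\<^sub>R u"
        using normalized_direction by blast
      have "edge_direction u (Q i)"
        unfolding edge_direction_def using u v(1) pq by (metis scaleR_scaleR)
      moreover have "edge_direction u (Q j)"
        unfolding edge_direction_def using u v(2) pq' by (metis scaleR_scaleR)
      ultimately show False
        using assms(5) ij by blast
    qed
    have projQ: "\<forall>i<m. compact (proj_plane n ` Q i) \<and> proj_plane n ` Q i \<noteq> {}"
      using planarQ planar_polytope.polytope planar_polytope.nonempty polytope_imp_compact by blast
    have "card {v. v extreme_point_of (proj_plane n ` P)} = card (edge_normals n (proj_plane n ` P))"
      using planar_polytope.card_edge_normals[OF planarP] by simp
    also have "\<dots> = card (\<Union>i<m. edge_normals n (proj_plane n ` Q i))"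
      by (simp add: assms(2) proj_plane_image_minkowski_sum edge_normals_minkowski_sum[OF projQ])
    also have "\<dots> = (\<Sum>i<m. card (edge_normals n (proj_plane n ` Q i)))"
      by (rule card_UN_disjoint)
        (use disjoint planarQ planar_polytope.finite_edge_normals in auto)
    also have "\<dots> = k"
      unfolding k_def
    proof (rule sum.cong)
      fix i assume "i \<in> {..<m}"
      then have i: "i < m"
        by simp
      have "card (edge_normals n (proj_plane n ` Q i))
          = card {v. v extreme_point_of (proj_plane n ` Q i)}"
        using planar_polytope.card_edge_normals[OF planarQ[OF i]] .
      \<comment> \<open>The projection is injective on \<open>Q i\<close>, so it neither loses nor
        merges vertices.\<close>
      also have "\<dots> = card (proj_plane n ` {v. v extreme_point_of Q i})"
        using extreme_points_of_linear_image_inj_on[OF linear_proj_plane injQ[OF i]] polyQ(1)[OF i]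
          polytope_imp_convex by metis
      also have "\<dots> = card {v. v extreme_point_of Q i}"
        by (rule card_image)
          (auto intro: inj_on_subset[OF injQ[OF i]] simp: extreme_point_of_def)
      finally show "card (edge_normals n (proj_plane n ` Q i)) = card {v. v extreme_point_of Q i}" .
    qed simp
    finally show ?thesis
      using planarP planar_polytope_aff_dim planar_polytope.polytope
      by (auto simp: polygon_def proj)
  qed
  then show ?thesis
    unfolding equiprojective_def k_equiprojective_def by blast
qed

end
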